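(* Let $X,Y$ be LCTV spaces, $\phi\colon X\times Y\to\overline{\mathbb R}$ an int-nearly convex function, $F\colon X\rightrightarrows Y$ an int-nearly convex set-valued mapping, and let $\mu(x):=\inf\{\phi(x,y)\mid y\in F(x)\}$ for $x\in X$. Assume that $$\operatorname{int}(\operatorname{epi}\phi)\cap\operatorname{int}\big((\operatorname{gph}F)\times\mathbb R\big)\neq\emptyset.$$ Then for every $x^*\in X^*$, $$\mu^*(x^* )=(\phi^*\square F^* )(x^*,0).$$
   Context: LCTV space means real locally convex Hausdorff topological vector space; $X^*$ is the topological dual and $\langle x^*,x\rangle=x^*(x)$; $(X\times Y)^*$ is identified with $X^*\times Y^*$. $\overline{\mathbb R}=\mathbb R\cup\{-\infty\}\cup\{\infty\}$ and $\inf\emptyset=\infty$. $\operatorname{epi}f=\{(x,\lambda)\in X\times\mathbb R\mid f(x)\le\lambda\}$, $\operatorname{gph}F=\{(x,y)\mid y\in F(x)\}$. A set $\Omega$ is int-nearly convex if there is a convex set $C$ with $\operatorname{int}C\ne\emptyset$ and $C\subset\Omega\subset\overline C$; a function (resp. set-valued mapping) is int-nearly convex if its epigraph (resp. graph) is. In the displayed condition $(\operatorname{gph}F)\times\mathbb R\subset X\times Y\times\mathbb R$. The Fenchel conjugate of $f\colon X\to\overline{\mathbb R}$ is $f^*(x^* )=\sup\{\langle x^*,x\rangle-f(x)\mid x\in X\}$. The Fenchel conjugate of the set-valued mapping $F$ is $F^*(x^*,y^* )=\sup\{\langle x^*,x\rangle+\langle y^*,y\rangle\mid(x,y)\in\operatorname{gph}F\}$.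 The infimal convolution is $(f\square h)(z)=\inf\{f(z_1)+h(z_2)\mid z_1+z_2=z\}$, so that $(\phi^*\square F^* )(x^*,0)=\inf\{\phi^*(x_1^*,y^* )+F^*(x_2^*,-y^* )\mid x_1^*+x_2^*=x^*,\ x_1^*,x_2^*\in X^*,\ y^*\in Y^*\}$. *)

theory Defs
  imports "HOL-Analysis.Analysis"
begin

section \<open>Real locally convex Hausdorff topological vector spaces\<close>

text \<open>
  The set \<open>V\<close> below is convex: \<^const>\<open>convex\<close> is not available for the type parameter of a class
  specification, so its definition is unfolded.
\<close>

class lctvs = real_vector + topological_ab_group_add + t2_space +
  assumes tendsto_scaleR_Pair:
      "LIM p (nhds c \<times>\<^sub>F nhds x). fst p *\<^sub>R snd p :> nhds (c *\<^sub>R x)"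
    and locally_convex_0_raw:
      "open U \<Longrightarrow> 0 \<in> U \<Longrightarrow> \<exists>V. open V \<and> 0 \<in> V \<and> V \<subseteq> U \<and>
        (\<forall>x\<in>V. \<forall>y\<in>V. \<forall>u\<ge>0. \<forall>v\<ge>0. u + v = 1 \<longrightarrow> u *\<^sub>R x + v *\<^sub>R y \<in> V)"

lemma locally_convex_0:
  "open U \<Longrightarrow> (0::'a::lctvs) \<in> U \<Longrightarrow> \<exists>V. open V \<and> 0 \<in> V \<and> V \<subseteq> U \<and> convex V"
  unfolding convex_def by (rule locally_convex_0_raw)

instance real_normed_vector \<subseteq> lctvs
proof
  fix c :: real and x :: 'a
  show "LIM p (nhds c \<times>\<^sub>F nhds x). fst p *\<^sub>R snd p :> nhds (c *\<^sub>R x)"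
    by (intro tendsto_scaleR filterlim_fst filterlim_snd)
next
  fix U :: "'a set"
  assume "open U" "0 \<in> U"
  then obtain e where "e > 0" "ball 0 e \<subseteq> U"
    by (auto simp: open_contains_ball)
  then show "\<exists>V. open V \<and> 0 \<in> V \<and> V \<subseteq> U \<and>
      (\<forall>x\<in>V. \<forall>y\<in>V. \<forall>u\<ge>0. \<forall>v\<ge>0. u + v = 1 \<longrightarrow> u *\<^sub>R x + v *\<^sub>R y \<in> V)"
    unfolding convex_def[symmetric] by (intro exI[of _ "ball 0 e"]) auto
qed

lemma continuous_on_scaleR_lctvs [continuous_intros]:
  fixes g :: "'c::topological_space \<Rightarrow> 'a::lctvs"
  assumes "continuous_on S f" "continuous_on S g"
  shows "continuous_on S (\<lambda>x. f x *\<^sub>R g x)"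
  unfolding continuous_on_def
proof
  fix x assume "x \<in> S"
  then have "(f \<longlongrightarrow> f x) (at x within S)" "(g \<longlongrightarrow> g x) (at x within S)"
    using assms by (auto simp: continuous_on_def)
  then have "LIM y (at x within S). (f y, g y) :> (nhds (f x) \<times>\<^sub>F nhds (g x))"
    by (rule filterlim_Pair)
  from filterlim_compose[OF tendsto_scaleR_Pair this]
  show "((\<lambda>x. f x *\<^sub>R g x) \<longlongrightarrow> f x *\<^sub>R g x) (at x within S)"
    by simp
qed

lemma tendsto_nhds_if_continuous:
  "continuous_on UNIV f \<Longrightarrow> (f \<longlongrightarrow> f x) (nhds x)"
  by (metis UNIV_I continuous_on_def tendsto_at_iff_tendsto_nhds)

text \<open>The superclass instances are declared one by one, because Isabelle only generalises the existing
  arities for normed spaces in this order.\<close>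

instance prod :: (topological_monoid_add, topological_monoid_add) topological_monoid_add
proof
  fix a b :: "'a \<times> 'b"
  have "continuous_on UNIV (\<lambda>p :: ('a \<times> 'b) \<times> ('a \<times> 'b).
          (fst (fst p) + fst (snd p), snd (fst p) + snd (snd p)))"
    by (intro continuous_intros)
  from tendsto_nhds_if_continuous[OF this, of "(a, b)"]
  show "LIM x (nhds a \<times>\<^sub>F nhds b). fst x + snd x :> nhds (a + b)"
    by (simp add: nhds_prod plus_prod_def)
qed

instance prod :: (topological_comm_monoid_add, topological_comm_monoid_add) topological_comm_monoid_add ..

instance prod :: (topological_group_add, topological_group_add) topological_group_add
proof
  fix a :: "'a \<times> 'b"
  have "continuous_on UNIV (\<lambda>p :: 'a \<times> 'b. (- fst p, - snd p))"
    by (intro continuous_intros)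
  from tendsto_nhds_if_continuous[OF this, of a]
  show "(uminus \<longlongrightarrow> - a) (nhds a)"
    by (simp add: uminus_prod_def [abs_def])
qed

instance prod :: (topological_ab_group_add, topological_ab_group_add) topological_ab_group_add ..

instance prod :: (lctvs, lctvs) lctvs
proof
  fix c :: real and a :: "'a \<times> 'b"
  have "continuous_on UNIV (\<lambda>p :: real \<times> ('a \<times> 'b).
          (fst p *\<^sub>R fst (snd p), fst p *\<^sub>R snd (snd p)))"
    by (intro continuous_intros)
  from tendsto_nhds_if_continuous[OF this, of "(c, a)"]
  show "LIM p (nhds c \<times>\<^sub>F nhds a). fst p *\<^sub>R snd p :> nhds (c *\<^sub>R a)"
    by (simp add: nhds_prod scaleR_prod_def)
next
  fix U :: "('a \<times> 'b) set"
  assume "open U" "0 \<in> U"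
  then obtain A B where AB: "open A" "open B" "(0::'a) \<in> A" "(0::'b) \<in> B" "A \<times> B \<subseteq> U"
    unfolding zero_prod_def by (metis mem_Sigma_iff open_prod_elim)
  obtain V W where "open V" "convex V" "0 \<in> V" "V \<subseteq> A" "open W" "convex W" "0 \<in> W" "W \<subseteq> B"
    using AB locally_convex_0 by metis
  with AB show "\<exists>V. open V \<and> 0 \<in> V \<and> V \<subseteq> U \<and>
      (\<forall>x\<in>V. \<forall>y\<in>V. \<forall>u\<ge>0. \<forall>v\<ge>0. u + v = 1 \<longrightarrow> u *\<^sub>R x + v *\<^sub>R y \<in> V)"
    unfolding convex_def[symmetric]
    by (intro exI[of _ "V \<times> W"]) (auto simp: open_Times convex_Times zero_prod_def)
qed


section \<open>Topological dual\<close>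

typedef (overloaded) 'a topdual = "{f :: 'a::lctvs \<Rightarrow> real. linear f \<and> continuous_on UNIV f}"
  morphisms dual_apply Abs_topdual
  by (rule exI[of _ "\<lambda>_. 0"]) (simp add: linear_zero)

setup_lifting type_definition_topdual

instantiation topdual :: (lctvs) ab_group_add
begin

lift_definition zero_topdual :: "'a topdual" is "\<lambda>_. 0"
  by (simp add: linear_zero)

lift_definition plus_topdual :: "'a topdual \<Rightarrow> 'a topdual \<Rightarrow> 'a topdual"
  is "\<lambda>f g x. f x + g x"
  by (simp add: linear_compose_add continuous_on_add)

lift_definition uminus_topdual :: "'a topdual \<Rightarrow> 'a topdual" is "\<lambda>f x. - f x"
  by (simp add: linear_compose_neg continuous_on_minus)

lift_definition minus_topdual :: "'a topdual \<Rightarrow> 'a topdual \<Rightarrow> 'a topdual"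
  is "\<lambda>f g x. f x - g x"
  by (simp add: linear_compose_sub continuous_on_diff)

instance
  by standard (transfer; simp add: fun_eq_iff)+

end

text \<open>The identification of \<open>X\<^sup>* \<times> Y\<^sup>*\<close> with \<open>(X \<times> Y)\<^sup>*\<close>.\<close>

lift_definition dual_pair ::
    "'a::lctvs topdual \<times> 'b::lctvs topdual \<Rightarrow> ('a \<times> 'b) topdual"
  is "\<lambda>(f, g) (x, y). f x + g y"
proof (clarsimp simp: case_prod_unfold, intro conjI)
  fix f :: "'a \<Rightarrow> real" and g :: "'b \<Rightarrow> real"
  assume lin: "linear f" "linear g" and cont: "continuous_on UNIV f" "continuous_on UNIV g"
  show "linear (\<lambda>p. f (fst p) + g (snd p))"
    by (rule linearI) (simp_all add: lin linear_add linear_scale algebra_simps)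
  have "continuous_on UNIV (\<lambda>p :: 'a \<times> 'b. f (fst p))" "continuous_on UNIV (\<lambda>p :: 'a \<times> 'b. g (snd p))"
    by (rule continuous_on_compose2[OF cont(1)] continuous_on_compose2[OF cont(2)];
        intro continuous_on_fst continuous_on_snd continuous_on_id subset_UNIV)+
  then show "continuous_on UNIV (\<lambda>p :: 'a \<times> 'b. f (fst p) + g (snd p))"
    by (rule continuous_on_add)
qed

lemma dual_apply_dual_pair [simp]:
  "dual_apply (dual_pair (f, g)) (x, y) = dual_apply f x + dual_apply g y"
  by transfer simp

lemma bij_dual_pair: "bij (dual_pair :: 'a::lctvs topdual \<times> 'b::lctvs topdual \<Rightarrow> _)"
proof (rule bijI)
  show "inj (dual_pair :: 'a topdual \<times> 'b topdual \<Rightarrow> _)"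
  proof (rule injI, clarify)
    fix f f' :: "'a topdual" and g g' :: "'b topdual"
    assume eq: "dual_pair (f, g) = dual_pair (f', g')"
    have lin: "linear (dual_apply h)" for h :: "'c::lctvs topdual"
      using dual_apply[of h] by simp
    have sum_eq: "dual_apply f x + dual_apply g y = dual_apply f' x + dual_apply g' y" for x y
      using arg_cong[OF eq, of "\<lambda>h. dual_apply h (x, y)"] by simp
    have "dual_apply f x = dual_apply f' x" for x
      using sum_eq[of x 0] by (simp add: linear_0[OF lin])
    moreover have "dual_apply g y = dual_apply g' y" for y
      using sum_eq[of 0 y] by (simp add: linear_0[OF lin])
    ultimately show "f = f' \<and> g = g'"
      by (simp add: dual_apply_inject[symmetric] fun_eq_iff)
  qed
next
  have "\<exists>p. h = dual_pair p" for h :: "('a \<times> 'b) topdual"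
  proof -
    let ?h = "dual_apply h"
    have lin: "linear ?h" and cont: "continuous_on UNIV ?h"
      using dual_apply[of h] by auto
    have "linear (\<lambda>x. ?h (x, 0))"
      using linear_compose[OF _ lin, of "\<lambda>x. (x, 0)"]
      by (simp add: comp_def linear_iff del: split_paired_All)
    moreover have "linear (\<lambda>y. ?h (0, y))"
      using linear_compose[OF _ lin, of "\<lambda>y. (0, y)"]
      by (simp add: comp_def linear_iff del: split_paired_All)
    moreover have "continuous_on UNIV (\<lambda>x. ?h (x, 0))" "continuous_on UNIV (\<lambda>y. ?h (0, y))"
      by (rule continuous_on_compose2[OF cont]; intro continuous_intros subset_UNIV)+
    ultimately have app: "dual_apply (Abs_topdual (\<lambda>x. ?h (x, 0))) = (\<lambda>x. ?h (x, 0))"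
      "dual_apply (Abs_topdual (\<lambda>y. ?h (0, y))) = (\<lambda>y. ?h (0, y))"
      by (simp_all add: Abs_topdual_inverse)
    have "?h (x, 0) + ?h (0, y) = ?h (x, y)" for x y
      using linear_add[OF lin, of "(x, 0)" "(0, y)"] by simp
    then have "h = dual_pair (Abs_topdual (\<lambda>x. ?h (x, 0)), Abs_topdual (\<lambda>y. ?h (0, y)))"
      by (simp add: dual_apply_inject[symmetric] fun_eq_iff app)
    then show ?thesis by blast
  qed
  then show "surj (dual_pair :: 'a topdual \<times> 'b topdual \<Rightarrow> _)"
    by (auto simp: surj_def)
qed


section \<open>Int-nearly convex sets, functions and set-valued mappings\<close>

definition epi :: "('a \<Rightarrow> ereal) \<Rightarrow> ('a \<times> real) set" where
  "epi f = {(x, r). f x \<le> ereal r}"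

definition gph :: "('a \<Rightarrow> 'b set) \<Rightarrow> ('a \<times> 'b) set" where
  "gph F = {(x, y). y \<in> F x}"

definition int_nearly_convex :: "'a::lctvs set \<Rightarrow> bool" where
  "int_nearly_convex S \<longleftrightarrow> (\<exists>C. convex C \<and> interior C \<noteq> {} \<and> C \<subseteq> S \<and> S \<subseteq> closure C)"

definition int_nearly_convex_fun :: "('a::lctvs \<Rightarrow> ereal) \<Rightarrow> bool" where
  "int_nearly_convex_fun f \<longleftrightarrow> int_nearly_convex (epi f)"

definition int_nearly_convex_map :: "('a::lctvs \<Rightarrow> 'b::lctvs set) \<Rightarrow> bool" where
  "int_nearly_convex_map F \<longleftrightarrow> int_nearly_convex (gph F)"


section \<open>Conjugates, infimal convolution and the optimal value function\<close>

definition conjugate :: "('a::lctvs \<Rightarrow> ereal) \<Rightarrow> 'a topdual \<Rightarrow> ereal" where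
  "conjugate f x' = (SUP x. ereal (dual_apply x' x) - f x)"

definition map_conjugate ::
    "('a::lctvs \<Rightarrow> 'b::lctvs set) \<Rightarrow> 'a topdual \<times> 'b topdual \<Rightarrow> ereal" where
  "map_conjugate F = (\<lambda>(x', y'). SUP (x, y) \<in> gph F. ereal (dual_apply x' x + dual_apply y' y))"

text \<open>In \<^typ>\<open>ereal\<close> the sum \<open>\<infinity> + (- \<infinity>)\<close> is \<open>\<infinity>\<close>.\<close>

definition inf_convolution :: "('v::ab_group_add \<Rightarrow> ereal) \<Rightarrow> ('v \<Rightarrow> ereal) \<Rightarrow> 'v \<Rightarrow> ereal" where
  "inf_convolution f h z = (INF (z1, z2) \<in> {(z1, z2). z1 + z2 = z}. f z1 + h z2)"

definition opt_value :: "('a \<times> 'b \<Rightarrow> ereal) \<Rightarrow> ('a \<Rightarrow> 'b set) \<Rightarrow> 'a \<Rightarrow> ereal" where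
  "opt_value \<phi> F x = (INF y \<in> F x. \<phi> (x, y))"

end

theory Submission
  imports Defs
begin

text \<open>
  The inequality \<open>\<le>\<close> is the Fenchel--Young estimate: for \<open>(x, y) \<in> gph F\<close> and \<open>x' = x1 + x2\<close>,
  \<open>x'(x) - \<phi>(x, y) = (x1(x) + y'(y) - \<phi>(x, y)) + (x2(x) - y'(y))\<close>,
  where the first bracket is at most the conjugate of \<open>\<phi>\<close> and the second one at most that of \<open>F\<close>
  (\<open>conjugate_opt_value_le\<close>).

  For \<open>\<ge>\<close> only a finite value \<open>\<alpha>\<close> of the left-hand side matters. It says that \<open>\<phi>\<close> lies above the
  affine function \<open>(x, y) \<mapsto> x'(x) - \<alpha>\<close> on \<open>gph F\<close>, so the epigraph of \<open>\<phi>\<close> does not meet the part of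
  \<open>gph F \<times> \<real>\<close> strictly below the graph of that function. Neither set need be convex, but each has an
  open convex core that is dense in it (\<open>int_nearly_convex_core\<close>). A closed hyperplane separates the
  cores, and by density it has the two original sets on its two sides. The hyperplane is not vertical,
  because a point of the domain of \<open>\<phi>\<close> lies in the interior of \<open>gph F\<close>: a vertical one would
  give a nonzero functional with a maximum over an open set. A non-vertical hyperplane is the graph of
  an affine function between the two sets, and its slope splits \<open>(x', 0)\<close> into a part for \<open>\<phi>\<close> and a
  part for \<open>F\<close> whose conjugates sum to at most \<open>\<alpha>\<close>. This is \<open>conjugate_restriction_split\<close>, which
  also shows that the infimum on the right-hand side is attained.

  The separating hyperplane comes from the Hahn--Banach theorem, proved here in the form that every
  sublinear functional dominates a linear one (\<open>linear_le_sublinear\<close>): Zorn's lemma provides a minimal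
  sublinear functional below the given one, and a minimal sublinear functional is linear. Applied to
  the gauge that a convex cone induces along one of its elements, this gives a continuous functional that is positive on a
  given open convex set missing the origin (\<open>topdual_positive_on_open_convex\<close>); the difference of two
  disjoint convex sets, one of them open, is such a set.
\<close>

section \<open>Linear functionals below sublinear ones\<close>

text \<open>
  For homogeneity an inequality is enough: applied to \<open>t\<close> and to \<open>1 / t\<close> it gives equality.
\<close>

definition sublinear :: "('v::real_vector \<Rightarrow> real) \<Rightarrow> bool" where
  "sublinear p \<longleftrightarrow> (\<forall>x y. p (x + y) \<le> p x + p y) \<and> (\<forall>t>0. \<forall>x. p (t *\<^sub>R x) \<le> t * p x)"

lemma sublinearI:
  assumes "\<And>x y. p (x + y) \<le> p x + p y" "\<And>t x. t > 0 \<Longrightarrow> p (t *\<^sub>R x) \<le> t * p x"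
  shows "sublinear p"
  using assms by (simp add: sublinear_def)

lemma sublinear_add: "sublinear p \<Longrightarrow> p (x + y) \<le> p x + p y"
  by (simp add: sublinear_def)

lemma sublinear_scale:
  assumes p: "sublinear p" and "t > 0"
  shows "p (t *\<^sub>R x) = t * p x"
proof (rule antisym)
  show "p (t *\<^sub>R x) \<le> t * p x"
    using assms by (simp add: sublinear_def)
  have "p (inverse t *\<^sub>R t *\<^sub>R x) \<le> inverse t * p (t *\<^sub>R x)"
    using p \<open>t > 0\<close> unfolding sublinear_def by (meson inverse_positive_iff_positive)
  then show "t * p x \<le> p (t *\<^sub>R x)"
    using \<open>t > 0\<close> by (simp add: field_simps)
qed

lemma sublinear_0: "sublinear p \<Longrightarrow> p 0 = 0"
  using sublinear_scale[of p 2 0] by simp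

lemma sublinear_uminus: "sublinear p \<Longrightarrow> - p (- x) \<le> p x"
  using sublinear_add[of p x "- x"] by (simp add: sublinear_0)

text \<open>
  Subadditivity survives the infimum because of the chain condition: two members \<open>q\<close> and \<open>r\<close> chosen
  for \<open>x\<close> and for \<open>y\<close> can both be replaced by the smaller of them.
\<close>

lemma sublinear_INF_chain:
  fixes Q :: "('v::real_vector \<Rightarrow> real) set"
  assumes ne: "Q \<noteq> {}" and sub: "\<And>q. q \<in> Q \<Longrightarrow> sublinear q"
    and chain: "\<And>q r. q \<in> Q \<Longrightarrow> r \<in> Q \<Longrightarrow> q \<le> r \<or> r \<le> q"
    and bdd: "\<And>x. bdd_below ((\<lambda>q. q x) ` Q)"
  shows "sublinear (\<lambda>x. INF q\<in>Q. q x)"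
proof (rule sublinearI)
  let ?u = "\<lambda>x. INF q\<in>Q. q x"
  have lower: "?u x \<le> q x" if "q \<in> Q" for q x
    using cINF_lower[OF bdd that] .
  fix x y
  have *: "?u (x + y) \<le> q x + r y" if qr: "q \<in> Q" "r \<in> Q" for q r
  proof -
    obtain s where s: "s \<in> Q" "s \<le> q" "s \<le> r"
      using chain[OF qr] qr by blast
    have "?u (x + y) \<le> s x + s y"
      using lower[OF s(1), of "x + y"] sublinear_add[OF sub[OF s(1)], of x y] by linarith
    also have "\<dots> \<le> q x + r y"
      using s by (intro add_mono) (auto simp: le_fun_def)
    finally show ?thesis .
  qed
  have "?u (x + y) - q x \<le> ?u y" if "q \<in> Q" for q
    using *[OF that] by (intro cINF_greatest[OF ne]) (simp add: algebra_simps)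
  then have "?u (x + y) - ?u y \<le> ?u x"
    by (intro cINF_greatest[OF ne]) (simp add: algebra_simps)
  then show "?u (x + y) \<le> ?u x + ?u y"
    by simp
next
  let ?u = "\<lambda>x. INF q\<in>Q. q x"
  fix t :: real and x assume t: "t > 0"
  have "?u (t *\<^sub>R x) / t \<le> q x" if "q \<in> Q" for q
    using cINF_lower[OF bdd that, of "t *\<^sub>R x"] sublinear_scale[OF sub[OF that] t, of x] t
    by (simp add: field_simps)
  then have "?u (t *\<^sub>R x) / t \<le> ?u x"
    by (rule cINF_greatest[OF ne])
  then show "?u (t *\<^sub>R x) \<le> t * ?u x"
    using t by (simp add: field_simps)
qed

text \<open>
  Fix \<open>y\<close> and lower \<open>q\<close> as far as possible towards being additive in the direction \<open>y\<close>, by passing to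
  \<open>r x = inf {q (x + t y) - t q y | t \<ge> 0}\<close>. This is again sublinear and \<open>r \<le> q\<close>, so minimality gives
  \<open>q = r\<close>. The term \<open>t = 1\<close> then says \<open>q x + q y \<le> q (x + y)\<close>, and \<open>q\<close> is additive.
\<close>

lemma minimal_sublinear_linear:
  fixes q :: "'v::real_vector \<Rightarrow> real"
  assumes q: "sublinear q" and minimal: "\<And>r. sublinear r \<Longrightarrow> r \<le> q \<Longrightarrow> r = q"
  shows "linear q"
proof -
  have super: "q x + q y \<le> q (x + y)" for x y
  proof -
    define r where "r = (\<lambda>x. INF t\<in>{0..}. q (x + t *\<^sub>R y) - t * q y)"
    have bound: "- q (- x) \<le> q (x + t *\<^sub>R y) - t * q y" if "t \<ge> 0" for x t
    proof -
      have "t * q y = q (t *\<^sub>R y)"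
        using that sublinear_scale[OF q, of t y] sublinear_0[OF q] by (cases "t = 0") auto
      also have "\<dots> \<le> q (x + t *\<^sub>R y) + q (- x)"
        using sublinear_add[OF q, of "x + t *\<^sub>R y" "- x"] by simp
      finally show ?thesis by simp
    qed
    have lower: "r x \<le> q (x + t *\<^sub>R y) - t * q y" if "t \<ge> 0" for x t
      unfolding r_def using that by (intro cINF_lower bdd_belowI2[OF bound]) auto
    have greatest: "c \<le> r x" if "\<And>t. t \<ge> 0 \<Longrightarrow> c \<le> q (x + t *\<^sub>R y) - t * q y" for c x
      unfolding r_def using that by (intro cINF_greatest) auto
    have "sublinear r"
    proof (rule sublinearI)
      fix x1 x2
      have *: "r (x1 + x2) \<le> (q (x1 + s *\<^sub>R y) - s * q y) + (q (x2 + t *\<^sub>R y) - t * q y)"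
        if "s \<ge> 0" "t \<ge> 0" for s t
        using lower[of "s + t" "x1 + x2"] that
          sublinear_add[OF q, of "x1 + s *\<^sub>R y" "x2 + t *\<^sub>R y"]
        by (simp add: algebra_simps)
      have "r (x1 + x2) - (q (x1 + s *\<^sub>R y) - s * q y) \<le> r x2" if "s \<ge> 0" for s
        using *[OF that] by (intro greatest) (simp add: algebra_simps)
      then have "r (x1 + x2) - r x2 \<le> r x1"
        by (intro greatest) (simp add: algebra_simps)
      then show "r (x1 + x2) \<le> r x1 + r x2" by simp
    next
      fix s :: real and x assume s: "s > 0"
      have "r (s *\<^sub>R x) / s \<le> q (x + t *\<^sub>R y) - t * q y" if "t \<ge> 0" for t
        using lower[of "s * t" "s *\<^sub>R x"] that s sublinear_scale[OF q s, of "x + t *\<^sub>R y"]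
        by (simp add: field_simps scaleR_add_right)
      then have "r (s *\<^sub>R x) / s \<le> r x"
        by (rule greatest)
      then show "r (s *\<^sub>R x) \<le> s * r x"
        using s by (simp add: field_simps)
    qed
    moreover have "r \<le> q"
      using lower[of 0] by (simp add: le_fun_def)
    ultimately have "r = q"
      by (rule minimal)
    then show ?thesis
      using lower[of 1 x] by simp
  qed
  have add: "q (x + y) = q x + q y" for x y
    using super sublinear_add[OF q] by (rule antisym[rotated])
  have neg: "q (- x) = - q x" for x
    using add[of x "- x"] by (simp add: sublinear_0[OF q])
  have "q (c *\<^sub>R x) = c * q x" for c x
  proof (cases c "0 :: real" rule: linorder_cases)
    case less
    then show ?thesis
      using sublinear_scale[OF q, of "- c" x] neg[of "c *\<^sub>R x"] by simp
  next
    case equal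
    then show ?thesis by (simp add: sublinear_0[OF q])
  next
    case greater
    then show ?thesis by (rule sublinear_scale[OF q])
  qed
  then show ?thesis
    by (intro linearI) (simp_all add: add)
qed

text \<open>
  Chains of sublinear functionals below \<open>p\<close> have a lower bound by \<open>sublinear_INF_chain\<close>: at each point
  \<open>x\<close> their values stay above \<open>- p (- x)\<close>, so the pointwise infimum is finite.
\<close>

lemma linear_le_sublinear:
  fixes p :: "'v::real_vector \<Rightarrow> real"
  assumes p: "sublinear p"
  obtains f where "linear f" "f \<le> p"
proof -
  define S where "S = {q. sublinear q \<and> q \<le> p}"
  have "\<exists>q\<in>S. \<forall>r\<in>S. q \<ge> r \<longrightarrow> r = q"
  proof (rule predicate_Zorn)
    show "partial_order_on S (relation_of (\<ge>) S)"
      by (rule partial_order_on_relation_ofI) auto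
  next
    fix Q assume "Q \<in> Chains (relation_of (\<ge>) S)"
    then have Q: "Q \<subseteq> S" and chain: "\<And>q r. q \<in> Q \<Longrightarrow> r \<in> Q \<Longrightarrow> q \<le> r \<or> r \<le> q"
      by (auto simp: Chains_def relation_of_def)
    show "\<exists>u\<in>S. \<forall>q\<in>Q. q \<ge> u"
    proof (cases "Q = {}")
      case True
      then show ?thesis using p by (auto simp: S_def)
    next
      case False
      have "- p (- x) \<le> q x" if "q \<in> Q" for q x
      proof -
        have "sublinear q" "q (- x) \<le> p (- x)"
          using Q that by (auto simp: S_def le_fun_def)
        then show ?thesis
          using sublinear_uminus[of q x] by linarith
      qed
      then have bdd: "bdd_below ((\<lambda>q. q x) ` Q)" for x
        by (rule bdd_belowI2)
      define u where "u = (\<lambda>x. INF q\<in>Q. q x)"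
      have lower: "u \<le> q" if "q \<in> Q" for q
        unfolding u_def using cINF_lower[OF bdd that] by (simp add: le_fun_def)
      have "sublinear u"
        unfolding u_def using Q chain
        by (intro sublinear_INF_chain[OF False] bdd) (auto simp: S_def)
      moreover have "u \<le> p"
        using False lower Q by (force simp: S_def intro: order_trans)
      ultimately show ?thesis
        using lower by (auto simp: S_def)
    qed
  qed
  then obtain q where q: "sublinear q" "q \<le> p"
    and min: "\<And>r. sublinear r \<Longrightarrow> r \<le> p \<Longrightarrow> r \<le> q \<Longrightarrow> r = q"
    by (auto simp: S_def)
  have "linear q"
    using q min by (intro minimal_sublinear_linear) (auto intro: order_trans)
  with q that show thesis by blast
qed


section \<open>Separation of convex sets\<close>

lemma linear_dual_apply: "linear (dual_apply f)"
  using dual_apply[of f] by simp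

lemma continuous_on_dual_apply: "continuous_on S (dual_apply f)"
  using dual_apply[of f] continuous_on_subset[OF _ subset_UNIV] by blast

lemma topdual_obtain:
  assumes "linear f" "continuous_on UNIV f"
  obtains f' where "\<And>x. dual_apply f' x = f x"
  using assms Abs_topdual_inverse[of f] that[of "Abs_topdual f"] by simp

lemma dual_apply_uminus: "dual_apply (- f) x = - dual_apply f x"
  by transfer simp

lemma dual_apply_minus: "dual_apply (f - g) x = dual_apply f x - dual_apply g x"
  by transfer simp

lemma topdual_eqI: "(\<And>x. dual_apply f x = dual_apply g x) \<Longrightarrow> f = g"
  by (simp add: dual_apply_inject[symmetric] fun_eq_iff)

lemma open_contains_step:
  fixes U :: "'v::lctvs set"
  assumes "open U" "u \<in> U"
  obtains e where "e > 0" "u + e *\<^sub>R x \<in> U"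
proof -
  have cont: "continuous_on UNIV (\<lambda>e::real. u + e *\<^sub>R x)"
    by (intro continuous_intros)
  have "open ((\<lambda>e::real. u + e *\<^sub>R x) -` U)"
    using open_vimage[OF \<open>open U\<close> cont] .
  moreover have "0 \<in> (\<lambda>e::real. u + e *\<^sub>R x) -` U"
    using \<open>u \<in> U\<close> by simp
  ultimately obtain d where "d > 0" "ball 0 d \<subseteq> (\<lambda>e::real. u + e *\<^sub>R x) -` U"
    by (rule openE)
  then have "u + (d / 2) *\<^sub>R x \<in> U"
    by (auto simp: subset_iff)
  with \<open>d > 0\<close> that[of "d / 2"] show thesis by simp
qed

text \<open>
  If \<open>u \<plusminus> (y - x) / d\<close> both lie in \<open>U\<close>, then nonnegativity at these two points bounds
  \<open>f y - f x\<close> by \<open>d * f u\<close> in absolute value; and they lie in \<open>U\<close> for all \<open>y\<close> near \<open>x\<close>.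
\<close>

lemma linear_nonneg_on_open_continuous:
  fixes f :: "'v::lctvs \<Rightarrow> real"
  assumes f: "linear f" and U: "open U" "u \<in> U" and nonneg: "\<And>x. x \<in> U \<Longrightarrow> f x \<ge> 0"
  shows "continuous_on UNIV f"
  unfolding continuous_on_def
proof
  fix x
  show "(f \<longlongrightarrow> f x) (at x)"
  proof (rule tendstoI)
    fix e :: real assume "e > 0"
    \<comment> \<open>The summand \<open>1\<close> makes \<open>d * f u < e\<close> and covers the case \<open>f u = 0\<close>.\<close>
    define d where "d = e / (f u + 1)"
    have fu: "f u \<ge> 0" using U nonneg by blast
    have d: "d > 0" using \<open>e > 0\<close> fu by (simp add: d_def)
    define N where "N = (\<lambda>y. u + inverse d *\<^sub>R (y - x)) -` U \<inter> (\<lambda>y. u - inverse d *\<^sub>R (y - x)) -` U"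
    have "open N"
      unfolding N_def by (intro open_Int open_vimage U continuous_intros)
    moreover have "x \<in> N"
      using U by (simp add: N_def)
    moreover have "dist (f y) (f x) < e" if "y \<in> N" for y
    proof -
      have "0 \<le> f u + inverse d * (f y - f x)" "0 \<le> f u - inverse d * (f y - f x)"
        using that nonneg[of "u + inverse d *\<^sub>R (y - x)"] nonneg[of "u - inverse d *\<^sub>R (y - x)"]
        by (auto simp: N_def linear_add[OF f] linear_diff[OF f] linear_scale[OF f])
      then have "\<bar>f y - f x\<bar> \<le> d * f u"
        using d by (simp add: field_simps abs_le_iff)
      also have "\<dots> < e"
        using \<open>e > 0\<close> fu by (simp add: d_def field_simps)
      finally show ?thesis by (simp add: dist_real_def)
    qed
    ultimately show "\<forall>\<^sub>F y in at x. dist (f y) (f x) < e"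
      unfolding eventually_at_topological by blast
  qed
qed

text \<open>
  Let \<open>K\<close> be the convex cone (without apex) generated by \<open>U\<close>, and fix \<open>u0 \<in> U\<close>. As \<open>U\<close> is open, every
  vector enters \<open>K\<close> after adding a multiple of \<open>u0\<close>; as \<open>0 \<notin> K\<close>, arbitrarily negative multiples do not
  work. So \<open>p x = inf {s. s u0 - x \<in> K}\<close> is a finite sublinear functional. It satisfies \<open>p (- u) \<le> 0\<close>
  for \<open>u \<in> U\<close> and \<open>p (- u0) < 0\<close>, so a linear \<open>f \<le> p\<close> is nonnegative on \<open>U\<close>, hence continuous, and
  positive at \<open>u0\<close>.
\<close>

lemma topdual_positive_on_open_convex:
  fixes U :: "'v::lctvs set"
  assumes U: "open U" "convex U" "U \<noteq> {}" "0 \<notin> U"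
  obtains f where "\<And>u. u \<in> U \<Longrightarrow> dual_apply f u > 0"
proof -
  obtain u0 where u0: "u0 \<in> U" using U by blast
  define K where "K = {t *\<^sub>R u | t u. t > 0 \<and> u \<in> U}"
  have K_scale: "t *\<^sub>R k \<in> K" if "t > 0" and k: "k \<in> K" for t k
  proof -
    obtain s u where "k = s *\<^sub>R u" "s > 0" "u \<in> U"
      using k by (auto simp: K_def)
    with \<open>t > 0\<close> show ?thesis
      unfolding K_def by (intro CollectI exI[of _ "t * s"] exI[of _ u]) simp
  qed
  have UK: "u \<in> K" if "u \<in> U" for u
    using that unfolding K_def by (intro CollectI exI[of _ 1] exI[of _ u]) simp
  have K0: "0 \<notin> K"
    using U by (auto simp: K_def)
  have K_add: "k + l \<in> K" if kl: "k \<in> K" "l \<in> K" for k l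
  proof -
    obtain s u t v where k: "k = s *\<^sub>R u" "s > 0" "u \<in> U" and l: "l = t *\<^sub>R v" "t > 0" "v \<in> U"
      using kl by (auto simp: K_def)
    have "(s / (s + t)) *\<^sub>R u + (t / (s + t)) *\<^sub>R v \<in> U"
      using k l by (intro convexD[OF \<open>convex U\<close>]) (auto simp flip: add_divide_distrib)
    then have "(s + t) *\<^sub>R ((s / (s + t)) *\<^sub>R u + (t / (s + t)) *\<^sub>R v) \<in> K"
      using k l by (intro K_scale UK) auto
    then show ?thesis
      using k l by (simp add: scaleR_add_right)
  qed
  have absorb: "\<exists>s. s *\<^sub>R u0 + x \<in> K" for x
  proof -
    obtain e where "e > 0" "u0 + e *\<^sub>R x \<in> U"
      using open_contains_step[OF U(1) u0] .
    then have "inverse e *\<^sub>R (u0 + e *\<^sub>R x) \<in> K"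
      by (intro K_scale UK) auto
    then show ?thesis
      using \<open>e > 0\<close> by (auto simp: scaleR_add_right)
  qed
  define p where "p = (\<lambda>x. Inf {s. s *\<^sub>R u0 - x \<in> K})"
  have ne: "{s. s *\<^sub>R u0 - x \<in> K} \<noteq> {}" for x
    using absorb[of "- x"] by simp
  have bdd: "bdd_below {s. s *\<^sub>R u0 - x \<in> K}" for x
  proof -
    obtain t where t: "t *\<^sub>R u0 + x \<in> K"
      using absorb by blast
    have "- t \<le> s" if s: "s *\<^sub>R u0 - x \<in> K" for s
    proof (rule ccontr)
      assume "\<not> - t \<le> s"
      then have "(- t - s) *\<^sub>R u0 \<in> K"
        using u0 by (intro K_scale UK) auto
      \<comment> \<open>Three elements of \<open>K\<close> whose sum is \<open>0\<close>.\<close>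
      from K_add[OF this K_add[OF s t]] show False
        using K0 by (simp add: algebra_simps)
    qed
    then show ?thesis
      by (intro bdd_belowI) auto
  qed
  have lower: "p x \<le> s" if "s *\<^sub>R u0 - x \<in> K" for s x
    unfolding p_def using that by (intro cInf_lower bdd) simp
  have greatest: "c \<le> p x" if "\<And>s. s *\<^sub>R u0 - x \<in> K \<Longrightarrow> c \<le> s" for c x
    unfolding p_def using that by (intro cInf_greatest ne) simp
  have "sublinear p"
  proof (rule sublinearI)
    fix x y
    have *: "p (x + y) \<le> s + t" if "s *\<^sub>R u0 - x \<in> K" "t *\<^sub>R u0 - y \<in> K" for s t
      using K_add[OF that] by (intro lower) (simp add: algebra_simps)
    have "p (x + y) - s \<le> p y" if "s *\<^sub>R u0 - x \<in> K" for s
      using *[OF that] by (intro greatest) (simp add: algebra_simps)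
    then have "p (x + y) - p y \<le> p x"
      by (intro greatest) (simp add: algebra_simps)
    then show "p (x + y) \<le> p x + p y" by simp
  next
    fix t :: real and x assume t: "t > 0"
    have "p (t *\<^sub>R x) \<le> t * s" if "s *\<^sub>R u0 - x \<in> K" for s
      using K_scale[OF t that] by (intro lower) (simp add: algebra_simps)
    then have "p (t *\<^sub>R x) / t \<le> p x"
      using t by (intro greatest) (simp add: field_simps)
    then show "p (t *\<^sub>R x) \<le> t * p x"
      using t by (simp add: field_simps)
  qed
  then obtain f where f: "linear f" "f \<le> p"
    by (rule linear_le_sublinear)
  have nonneg: "f u \<ge> 0" if "u \<in> U" for u
    using lower[of 0 "- u"] UK[OF that] le_funD[OF f(2), of "- u"] linear_neg[OF f(1), of u] by simp
  have "p (- u0) \<le> - 1 / 2"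
  proof (rule lower)
    have "(1 / 2) *\<^sub>R u0 \<in> K"
      using u0 by (intro K_scale UK) auto
    also have "(1 / 2) *\<^sub>R u0 = (- 1 / 2) *\<^sub>R u0 - - u0"
      using scaleR_left_distrib[of "- 1 / 2" 1 u0] by simp
    finally show "(- 1 / 2) *\<^sub>R u0 - - u0 \<in> K" .
  qed
  then have fu0: "f u0 > 0"
    using le_funD[OF f(2), of "- u0"] linear_neg[OF f(1), of u0] by simp
  \<comment> \<open>On an open set the nonnegative functional \<open>f\<close> cannot vanish: a small step in the direction
    \<open>- u0\<close> stays in \<open>U\<close> and strictly decreases \<open>f\<close>.\<close>
  have pos: "f u > 0" if u: "u \<in> U" for u
  proof -
    obtain e where e: "e > 0" "u + e *\<^sub>R (- u0) \<in> U"
      using open_contains_step[OF U(1) u] .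
    then have "0 \<le> f u - e * f u0"
      using nonneg[OF e(2)] by (simp add: linear_diff[OF f(1)] linear_scale[OF f(1)])
    with e fu0 show ?thesis
      by (smt (verit) mult_pos_pos)
  qed
  obtain f' where f': "\<And>x. dual_apply f' x = f x"
    using topdual_obtain[OF f(1) linear_nonneg_on_open_continuous[OF f(1) U(1) u0 nonneg]] by blast
  show thesis
    by (rule that[of f']) (simp add: f' pos)
qed

lemma topdual_separates_open_convex:
  fixes A B :: "'v::lctvs set"
  assumes A: "open A" "convex A" "A \<noteq> {}" and B: "convex B" "B \<noteq> {}" and disj: "A \<inter> B = {}"
  obtains f \<gamma> where "f \<noteq> 0" "\<And>a. a \<in> A \<Longrightarrow> \<gamma> \<le> dual_apply f a" "\<And>b. b \<in> B \<Longrightarrow> dual_apply f b \<le> \<gamma>"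
proof -
  define U where "U = (\<Union>b\<in>B. (\<lambda>x. x + b) -` A)"
  have "open U"
    unfolding U_def by (intro open_UN ballI open_vimage A continuous_intros)
  moreover have U_eq: "U = (\<Union>a\<in>A. \<Union>b\<in>B. {a - b})"
    unfolding U_def by force
  then have "convex U"
    using convex_differences[OF A(2) B(1)] by simp
  moreover have "U \<noteq> {}" "0 \<notin> U"
    using A B disj by (auto simp: U_eq)
  ultimately obtain f where f: "\<And>u. u \<in> U \<Longrightarrow> dual_apply f u > 0"
    using topdual_positive_on_open_convex by blast
  have less: "dual_apply f b < dual_apply f a" if "a \<in> A" "b \<in> B" for a b
    using f[of "a - b"] that by (auto simp: U_eq linear_diff[OF linear_dual_apply])
  obtain a0 where a0: "a0 \<in> A" using A(3) by blast
  have bdd: "bdd_above (dual_apply f ` B)"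
    using less[OF a0] by (intro bdd_aboveI2 less_imp_le)
  show thesis
  proof (rule that)
    show "f \<noteq> 0"
      using B(2) less[OF a0] by (auto simp: zero_topdual.rep_eq)
    show "(SUP b\<in>B. dual_apply f b) \<le> dual_apply f a" if "a \<in> A" for a
      using that less by (intro cSUP_least B(2)) (auto intro: less_imp_le)
    show "dual_apply f b \<le> (SUP b\<in>B. dual_apply f b)" if "b \<in> B" for b
      using that bdd by (rule cSUP_upper)
  qed
qed


section \<open>Interiors of convex sets\<close>

lemma open_scaled_translate:
  fixes U :: "'v::lctvs set"
  assumes "open U" "t \<noteq> 0"
  shows "open ((\<lambda>u. c + t *\<^sub>R u) ` U)"
proof -
  have "(\<lambda>u. c + t *\<^sub>R u) ` U = (\<lambda>x. inverse t *\<^sub>R (x - c)) -` U"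
  proof (intro equalityI subsetI)
    fix x assume "x \<in> (\<lambda>x. inverse t *\<^sub>R (x - c)) -` U"
    then show "x \<in> (\<lambda>u. c + t *\<^sub>R u) ` U"
      using \<open>t \<noteq> 0\<close> by (intro image_eqI[of _ _ "inverse t *\<^sub>R (x - c)"]) auto
  qed (use \<open>t \<noteq> 0\<close> in auto)
  then show ?thesis
    by (simp only:) (intro open_vimage assms continuous_intros)
qed

text \<open>
  The image of the interior under the homothety with centre \<open>c\<close> and ratio \<open>t\<close> is an open subset of \<open>C\<close>.
\<close>

lemma convex_interior_segment:
  fixes C :: "'v::lctvs set"
  assumes C: "convex C" and a: "a \<in> interior C" and c: "c \<in> C" and t: "0 < t" "t \<le> 1"
  shows "(1 - t) *\<^sub>R c + t *\<^sub>R a \<in> interior C"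
proof (rule interiorI)
  show "open ((\<lambda>u. (1 - t) *\<^sub>R c + t *\<^sub>R u) ` interior C)"
    using t by (intro open_scaled_translate) auto
  show "(\<lambda>u. (1 - t) *\<^sub>R c + t *\<^sub>R u) ` interior C \<subseteq> C"
    using t c interior_subset[of C] by (auto intro!: convexD[OF C])
qed (use a in auto)

lemma convex_interior_lctvs:
  fixes C :: "'v::lctvs set"
  assumes "convex C"
  shows "convex (interior C)"
proof (rule convexI)
  fix x y and u v :: real
  assume xy: "x \<in> interior C" "y \<in> interior C" and uv: "0 \<le> u" "0 \<le> v" "u + v = 1"
  show "u *\<^sub>R x + v *\<^sub>R y \<in> interior C"
  proof (cases "v = 0")
    case True
    then show ?thesis using xy uv by simp
  next
    case False
    then have "(1 - v) *\<^sub>R x + v *\<^sub>R y \<in> interior C"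
      using xy uv interior_subset by (intro convex_interior_segment assms) auto
    then show ?thesis using uv by (simp add: eq_diff_eq[symmetric])
  qed
qed

text \<open>
  Every \<open>c \<in> C\<close> is the limit, as \<open>t\<close> tends to \<open>0\<close>, of the points \<open>(1 - t) c + t a\<close> with \<open>a\<close> in the interior,
  and these are interior points.
\<close>

lemma convex_closure_interior_lctvs:
  fixes C :: "'v::lctvs set"
  assumes C: "convex C" and "interior C \<noteq> {}"
  shows "closure C \<subseteq> closure (interior C)"
proof (rule closure_minimal)
  obtain a where a: "a \<in> interior C" using assms by blast
  show "C \<subseteq> closure (interior C)"
  proof
    fix c assume c: "c \<in> C"
    have "continuous_on UNIV (\<lambda>t::real. (1 - t) *\<^sub>R c + t *\<^sub>R a)"
      by (intro continuous_intros)
    then have "(\<lambda>t. (1 - t) *\<^sub>R c + t *\<^sub>R a) ` closure {0<..<1} \<subseteq> closure (interior C)"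
      by (rule image_closure_subset[OF continuous_on_subset])
        (auto intro!: closure_subset[THEN subsetD] convex_interior_segment C a c)
    then have "(1 - 0) *\<^sub>R c + 0 *\<^sub>R a \<in> closure (interior C)"
      by (rule subsetD) (force simp: closure_greaterThanLessThan)
    then show "c \<in> closure (interior C)" by simp
  qed
qed simp

text \<open>
  The form in which near convexity is used: separation applies to the open convex set \<open>C\<close>, and the
  resulting weak inequalities extend to \<open>S\<close> by density.
\<close>

lemma int_nearly_convex_core:
  assumes "int_nearly_convex S"
  obtains C where "open C" "convex C" "C \<noteq> {}" "C \<subseteq> S" "S \<subseteq> closure C"
proof -
  obtain D where D: "convex D" "interior D \<noteq> {}" "D \<subseteq> S" "S \<subseteq> closure D"
    using assms by (auto simp: int_nearly_convex_def)
  show thesis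
  proof (rule that[of "interior D"])
    show "S \<subseteq> closure (interior D)"
      using D convex_closure_interior_lctvs by blast
    show "interior D \<subseteq> S"
      using D interior_subset by blast
  qed (use D convex_interior_lctvs in auto)
qed


section \<open>Conjugates of restrictions and of optimal value functions\<close>

lemma topdual_eq_0_if_max_on_open:
  fixes w :: "'v::lctvs topdual"
  assumes U: "open U" "q \<in> U" and le: "\<And>z. z \<in> U \<Longrightarrow> dual_apply w z \<le> dual_apply w q"
  shows "w = 0"
proof (rule topdual_eqI)
  have *: "dual_apply w x \<le> 0" for x
  proof -
    obtain e where e: "e > 0" "q + e *\<^sub>R x \<in> U"
      using open_contains_step[OF U] .
    from le[OF e(2)] e(1) show ?thesis
      by (simp add: linear_add[OF linear_dual_apply] linear_scale[OF linear_dual_apply] mult_le_0_iff)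
  qed
  fix x
  show "dual_apply w x = dual_apply 0 x"
    using *[of x] *[of "- x"] by (simp add: linear_neg[OF linear_dual_apply] zero_topdual.rep_eq)
qed

text \<open>
  A sum rule with exact splitting: a bound \<open>\<alpha>\<close> for the conjugate at \<open>z'\<close> of \<open>\<phi>\<close> restricted to \<open>D\<close> is
  shared between the conjugate of \<open>\<phi>\<close> and the support function of \<open>D\<close>. With a separating functional
  \<open>(z, r) \<mapsto> w z + c r\<close> and threshold \<open>\<gamma>\<close>, the point \<open>q\<close> forces \<open>c > 0\<close>; dividing by \<open>c\<close>, the epigraph
  side reads \<open>- w z / c - \<phi> z \<le> - \<gamma> / c\<close> and the other side \<open>w z / c + z' z \<le> \<gamma> / c + \<alpha>\<close> on \<open>D\<close>.
\<close>

lemma conjugate_restriction_split: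
  fixes \<phi> :: "'v::lctvs \<Rightarrow> ereal" and D :: "'v set" and z' :: "'v topdual"
  assumes \<phi>: "int_nearly_convex_fun \<phi>" and D: "int_nearly_convex D"
    and q: "q \<in> interior D" "\<phi> q < \<infinity>"
    and bound: "\<And>z. z \<in> D \<Longrightarrow> ereal (dual_apply z' z) - \<phi> z \<le> ereal \<alpha>"
  obtains w' \<beta> where "conjugate \<phi> (z' - w') \<le> ereal (\<alpha> - \<beta>)" "\<And>z. z \<in> D \<Longrightarrow> dual_apply w' z \<le> \<beta>"
proof -
  obtain A where A: "open A" "convex A" "A \<noteq> {}" "A \<subseteq> epi \<phi>" "epi \<phi> \<subseteq> closure A"
    using \<phi> int_nearly_convex_core unfolding int_nearly_convex_fun_def by blast
  obtain E where E: "open E" "convex E" "E \<noteq> {}" "E \<subseteq> D" "D \<subseteq> closure E"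
    using D int_nearly_convex_core by blast
  define B where "B = {(z, r). z \<in> E \<and> r < dual_apply z' z - \<alpha>}"
  have "convex B"
  proof (rule convexI, clarsimp simp: B_def, intro conjI)
    fix z1 z2 r1 r2 and u v :: real
    assume z: "z1 \<in> E" "z2 \<in> E" and r: "r1 < dual_apply z' z1 - \<alpha>" "r2 < dual_apply z' z2 - \<alpha>"
      and uv: "0 \<le> u" "0 \<le> v" "u + v = 1"
    show "u *\<^sub>R z1 + v *\<^sub>R z2 \<in> E"
      using z uv by (intro convexD[OF E(2)])
    have "u * r1 + v * r2 < u * (dual_apply z' z1 - \<alpha>) + v * (dual_apply z' z2 - \<alpha>)"
    proof (cases "u = 0")
      case False
      with r uv show ?thesis
        by (intro add_less_le_mono mult_strict_left_mono mult_left_mono) auto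
    qed (use r uv in auto)
    also have "\<dots> = dual_apply z' (u *\<^sub>R z1 + v *\<^sub>R z2) - (u + v) * \<alpha>"
      by (simp add: linear_add[OF linear_dual_apply] linear_scale[OF linear_dual_apply] algebra_simps)
    finally show "u * r1 + v * r2 < dual_apply z' (u *\<^sub>R z1 + v *\<^sub>R z2) - \<alpha>"
      using uv by simp
  qed
  moreover have "B \<noteq> {}"
  proof -
    obtain z where "z \<in> E" using E by blast
    then have "(z, dual_apply z' z - \<alpha> - 1) \<in> B" by (simp add: B_def)
    then show ?thesis by blast
  qed
  moreover have "A \<inter> B = {}"
  proof -
    have False if zr: "(z, r) \<in> A" "(z, r) \<in> B" for z r
    proof -
      have "\<phi> z \<le> ereal r" "z \<in> D" "r < dual_apply z' z - \<alpha>"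
        using A E zr by (auto simp: epi_def B_def)
      then show False
        using bound[of z] by (cases "\<phi> z") auto
    qed
    then show ?thesis by auto
  qed
  ultimately obtain f \<gamma> where f0: "f \<noteq> 0"
    and fA: "\<And>a. a \<in> A \<Longrightarrow> \<gamma> \<le> dual_apply f a" and fB: "\<And>b. b \<in> B \<Longrightarrow> dual_apply f b \<le> \<gamma>"
    using topdual_separates_open_convex[OF A(1-3), of B] by metis
  obtain w h where fwh: "f = dual_pair (w, h)"
    using bij_dual_pair by (metis bij_pointE surj_pair)
  define c where "c = dual_apply h 1"
  have f: "dual_apply f (z, r) = dual_apply w z + c * r" for z r
    using linear_scale[OF linear_dual_apply, of h r 1] by (simp add: fwh c_def)
  have f_epi: "\<gamma> \<le> dual_apply w z + c * r" if "\<phi> z \<le> ereal r" for z r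
  proof -
    have "(z, r) \<in> closure A"
      using that A by (auto simp: epi_def)
    from continuous_ge_on_closure[OF continuous_on_dual_apply this fA]
    show ?thesis by (simp add: f)
  qed
  \<comment> \<open>Passing from \<open>B\<close> to \<open>D\<close> takes two limits: first \<open>r\<close> rises to the bounding affine function over a
    point of \<open>E\<close>, then the point moves from \<open>E\<close> to its closure.\<close>
  have f_D: "dual_apply w z + c * (dual_apply z' z - \<alpha>) \<le> \<gamma>" if "z \<in> D" for z
  proof -
    have on_E: "dual_apply w z + c * (dual_apply z' z - \<alpha>) \<le> \<gamma>" if "z \<in> E" for z
    proof (rule tendsto_upperbound)
      show "((\<lambda>r. dual_apply w z + c * r) \<longlongrightarrow> dual_apply w z + c * (dual_apply z' z - \<alpha>))
          (at_left (dual_apply z' z - \<alpha>))"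
        by (intro tendsto_intros)
      show "\<forall>\<^sub>F r in at_left (dual_apply z' z - \<alpha>). dual_apply w z + c * r \<le> \<gamma>"
        using fB that by (auto simp: eventually_at_filter B_def simp flip: f)
    qed simp
    have "continuous_on (closure E) (\<lambda>z. dual_apply w z + c * (dual_apply z' z - \<alpha>))"
      by (intro continuous_intros continuous_on_dual_apply)
    then show ?thesis
      by (rule continuous_le_on_closure) (use that E on_E in blast)+
  qed
  obtain \<rho> where \<rho>: "\<phi> q \<le> ereal \<rho>"
    using q(2) by (cases "\<phi> q") auto
  have "c \<ge> 0"
  proof (rule ccontr)
    assume "\<not> c \<ge> 0"
    \<comment> \<open>A point of the epigraph above \<open>q\<close>, so high that \<open>w q + c r \<le> \<gamma> - 1\<close>.\<close>
    define r where "r = max \<rho> ((\<gamma> - dual_apply w q - 1) / c)"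
    have "\<phi> q \<le> ereal r"
      using \<rho> by (rule order_trans) (simp add: r_def)
    then have "\<gamma> \<le> dual_apply w q + c * r"
      by (rule f_epi)
    moreover have "c * r \<le> c * ((\<gamma> - dual_apply w q - 1) / c)"
      using \<open>\<not> c \<ge> 0\<close> by (intro mult_left_mono_neg) (auto simp: r_def)
    ultimately show False
      using \<open>\<not> c \<ge> 0\<close> by simp
  qed
  moreover have "c \<noteq> 0"
  proof
    assume "c = 0"
    \<comment> \<open>Here \<open>w \<le> \<gamma>\<close> on \<open>D\<close> and \<open>w q \<ge> \<gamma>\<close>, so \<open>w\<close> has a maximum over the interior of \<open>D\<close> at \<open>q\<close>.\<close>
    have "w = 0"
    proof (rule topdual_eq_0_if_max_on_open[OF open_interior q(1)])
      show "dual_apply w z \<le> dual_apply w q" if "z \<in> interior D" for z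
        using f_D[of z] f_epi[OF \<rho>] that interior_subset \<open>c = 0\<close> by force
    qed
    then have "f = 0"
      using f \<open>c = 0\<close> by (intro topdual_eqI) (auto simp: zero_topdual.rep_eq)
    with f0 show False ..
  qed
  ultimately have c: "c > 0" by simp
  have "linear (\<lambda>z. dual_apply w z / c + dual_apply z' z)"
    by (rule linearI) (simp_all add: linear_add[OF linear_dual_apply]
        linear_scale[OF linear_dual_apply] add_divide_distrib algebra_simps)
  moreover have "continuous_on UNIV (\<lambda>z. dual_apply w z / c + dual_apply z' z)"
    using c by (intro continuous_intros continuous_on_dual_apply) auto
  ultimately obtain w' where w': "\<And>z. dual_apply w' z = dual_apply w z / c + dual_apply z' z"
    using topdual_obtain by blast
  show thesis
  proof (rule that[of w' "\<gamma> / c + \<alpha>"])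
    show "dual_apply w' z \<le> \<gamma> / c + \<alpha>" if "z \<in> D" for z
      using divide_right_mono[OF f_D[OF that], of c] c by (simp add: w' add_divide_distrib)
    have "ereal (dual_apply (z' - w') z) - \<phi> z \<le> ereal (- \<gamma> / c)" for z
    proof -
      have eq: "dual_apply (z' - w') z = - dual_apply w z / c"
        by (simp add: dual_apply_minus w')
      have *: "ereal (- dual_apply w z / c) - ereal (- \<gamma> / c) \<le> ereal r" if "\<phi> z \<le> ereal r" for r
        using f_epi[OF that] c by (simp add: field_simps)
      show ?thesis
      proof (cases "\<phi> z")
        case (real r)
        then show ?thesis using *[of r] by (simp add: eq)
      next
        \<comment> \<open>Impossible: the inequality \<open>*\<close> would hold for every real \<open>r\<close>.\<close>
        case MInf
        then show ?thesis using *[of "- dual_apply w z / c + \<gamma> / c - 1"] by simp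
      qed simp
    qed
    then show "conjugate \<phi> (z' - w') \<le> ereal (\<alpha> - (\<gamma> / c + \<alpha>))"
      unfolding conjugate_def by (intro SUP_least) simp
  qed
qed

text \<open>
  The inner supremum over \<open>y \<in> F x\<close> of \<open>x'(x) - \<phi>(x, y)\<close> equals \<open>x'(x)\<close> minus the infimum defining the
  optimal value; where \<open>F x\<close> is empty, that value is \<open>\<infinity>\<close> and \<open>x\<close> contributes \<open>-\<infinity>\<close>.
\<close>

lemma conjugate_opt_value:
  "conjugate (opt_value \<phi> F) x' =
    (SUP (x, y) \<in> gph F. ereal (dual_apply x' x) - \<phi> (x, y))"
proof (rule antisym)
  show "conjugate (opt_value \<phi> F) x' \<le> (SUP (x, y) \<in> gph F. ereal (dual_apply x' x) - \<phi> (x, y))"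
    unfolding conjugate_def
  proof (rule SUP_least)
    fix x
    let ?S = "SUP (x, y) \<in> gph F. ereal (dual_apply x' x) - \<phi> (x, y)"
    have "ereal (dual_apply x' x) - ?S \<le> opt_value \<phi> F x"
      unfolding opt_value_def
    proof (rule INF_greatest)
      fix y assume "y \<in> F x"
      then have "ereal (dual_apply x' x) - \<phi> (x, y) \<le> ?S"
        by (intro SUP_upper2[of "(x, y)"]) (auto simp: gph_def)
      then show "ereal (dual_apply x' x) - ?S \<le> \<phi> (x, y)"
        by (cases ?S; cases "\<phi> (x, y)") auto
    qed
    then show "ereal (dual_apply x' x) - opt_value \<phi> F x \<le> ?S"
      by (cases ?S; cases "opt_value \<phi> F x") auto
  qed
  show "(SUP (x, y) \<in> gph F. ereal (dual_apply x' x) - \<phi> (x, y)) \<le> conjugate (opt_value \<phi> F) x'"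
  proof (rule SUP_least, clarify)
    fix x y assume "(x, y) \<in> gph F"
    then have "ereal (dual_apply x' x) - \<phi> (x, y) \<le> ereal (dual_apply x' x) - opt_value \<phi> F x"
      unfolding opt_value_def gph_def by (intro ereal_minus_mono order_refl INF_lower) simp
    also have "\<dots> \<le> conjugate (opt_value \<phi> F) x'"
      unfolding conjugate_def by (rule SUP_upper) simp
    finally show "ereal (dual_apply x' x) - \<phi> (x, y) \<le> conjugate (opt_value \<phi> F) x'" .
  qed
qed

lemma conjugate_opt_value_le:
  "conjugate (opt_value \<phi> F) (x1 + x2) \<le> conjugate \<phi> (dual_pair (x1, y')) + map_conjugate F (x2, - y')"
  unfolding conjugate_opt_value
proof (rule SUP_least, clarify)
  fix x y assume "(x, y) \<in> gph F"
  have "ereal (dual_apply (x1 + x2) x) - \<phi> (x, y) =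
      (ereal (dual_apply x1 x + dual_apply y' y) - \<phi> (x, y)) + ereal (dual_apply x2 x - dual_apply y' y)"
    by (cases "\<phi> (x, y)") (simp_all add: plus_topdual.rep_eq)
  also have "\<dots> \<le> conjugate \<phi> (dual_pair (x1, y')) + map_conjugate F (x2, - y')"
  proof (rule add_mono)
    show "ereal (dual_apply x1 x + dual_apply y' y) - \<phi> (x, y) \<le> conjugate \<phi> (dual_pair (x1, y'))"
      unfolding conjugate_def by (intro SUP_upper2[of "(x, y)"]) auto
    show "ereal (dual_apply x2 x - dual_apply y' y) \<le> map_conjugate F (x2, - y')"
      unfolding map_conjugate_def using \<open>(x, y) \<in> gph F\<close>
      by (auto intro!: SUP_upper2[of "(x, y)"] simp: dual_apply_uminus)
  qed
  finally show "ereal (dual_apply (x1 + x2) x) - \<phi> (x, y) \<le>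
      conjugate \<phi> (dual_pair (x1, y')) + map_conjugate F (x2, - y')" .
qed

theorem theorem5p3:
  fixes \<phi> :: "'a::lctvs \<times> 'b::lctvs \<Rightarrow> ereal"
    and F :: "'a \<Rightarrow> 'b set"
    and x' :: "'a topdual"
  assumes "int_nearly_convex_fun \<phi>"
    and "int_nearly_convex_map F"
    and "interior (epi \<phi>) \<inter> interior (gph F \<times> (UNIV :: real set)) \<noteq> {}"
  shows "conjugate (opt_value \<phi> F) x' =
    inf_convolution (conjugate \<phi> \<circ> dual_pair) (map_conjugate F) (x', 0)"
proof (rule antisym)
  show "conjugate (opt_value \<phi> F) x' \<le>
      inf_convolution (conjugate \<phi> \<circ> dual_pair) (map_conjugate F) (x', 0)"
    unfolding inf_convolution_def
  proof (rule INF_greatest, clarsimp)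
    fix x1 x2 and y1 y2 :: "'b topdual"
    assume "y1 + y2 = 0" "x' = x1 + x2"
    then have "y2 = - y1"
      by (simp add: eq_neg_iff_add_eq_0 add.commute)
    then show "conjugate (opt_value \<phi> F) (x1 + x2) \<le>
        conjugate \<phi> (dual_pair (x1, y1)) + map_conjugate F (x2, y2)"
      using conjugate_opt_value_le by blast
  qed
next
  obtain q \<rho> where q: "(q, \<rho>) \<in> interior (epi \<phi>)" "q \<in> interior (gph F)"
    using assms(3) by (auto simp: interior_Times)
  then have q': "\<phi> q \<le> ereal \<rho>" "q \<in> gph F"
    using interior_subset by (fastforce simp: epi_def)+
  obtain qx qy where q_eq: "q = (qx, qy)" by fastforce
  have upper: "ereal (dual_apply x' x) - \<phi> (x, y) \<le> conjugate (opt_value \<phi> F) x'"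
    if "(x, y) \<in> gph F" for x y
    unfolding conjugate_opt_value using that by (intro SUP_upper2[of "(x, y)"]) auto
  show "inf_convolution (conjugate \<phi> \<circ> dual_pair) (map_conjugate F) (x', 0) \<le>
      conjugate (opt_value \<phi> F) x'"
  proof (cases "conjugate (opt_value \<phi> F) x'")
    case PInf
    then show ?thesis by simp
  next
    \<comment> \<open>Excluded, since \<open>\<phi> q < \<infinity>\<close> at the point \<open>q\<close> of \<open>gph F\<close>.\<close>
    case MInf
    then show ?thesis
      using upper[of qx qy] q' by (cases "\<phi> q") (auto simp: q_eq)
  next
    case (real \<alpha>)
    obtain w' \<beta> where w': "conjugate \<phi> (dual_pair (x', 0) - w') \<le> ereal (\<alpha> - \<beta>)"
      "\<And>z. z \<in> gph F \<Longrightarrow> dual_apply w' z \<le> \<beta>"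
    proof (rule conjugate_restriction_split[OF assms(1) _ q(2)])
      show "int_nearly_convex (gph F)"
        using assms(2) by (simp add: int_nearly_convex_map_def)
      show "\<phi> q < \<infinity>"
        using q'(1) by (rule le_less_trans) simp
      show "ereal (dual_apply (dual_pair (x', 0)) z) - \<phi> z \<le> ereal \<alpha>" if "z \<in> gph F" for z
        using that upper[of "fst z" "snd z"] real by (cases z) (simp add: zero_topdual.rep_eq)
    qed blast
    obtain x2 y2 where w'_eq: "w' = dual_pair (x2, y2)"
      using bij_dual_pair by (metis bij_pointE surj_pair)
    have diff: "dual_pair (x', 0) - w' = dual_pair (x' - x2, - y2)"
      by (rule topdual_eqI)
        (auto simp: w'_eq dual_apply_minus dual_apply_uminus zero_topdual.rep_eq)
    have "inf_convolution (conjugate \<phi> \<circ> dual_pair) (map_conjugate F) (x', 0) \<le>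
        conjugate \<phi> (dual_pair (x' - x2, - y2)) + map_conjugate F (x2, y2)"
      unfolding inf_convolution_def
      by (rule INF_lower2[of "((x' - x2, - y2), (x2, y2))"]) auto
    also have "\<dots> \<le> ereal (\<alpha> - \<beta>) + ereal \<beta>"
    proof (rule add_mono)
      show "map_conjugate F (x2, y2) \<le> ereal \<beta>"
        unfolding map_conjugate_def using w'(2) by (auto intro!: SUP_least simp: w'_eq)
    qed (use w'(1) diff in simp)
    finally show ?thesis using real by simp
  qed
qed

end
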